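(* For any integer $n\ge2$, let $\nu_n(z)=1+\frac z{n^2-n}$ ($z\in\mathbb{C}$), $k_n=\frac{n(n+1)}2+1$ and $m_n=\frac{(n-1)(n-2)}2+1$. The stability function of the optimal third order SSP Runge--Kutta method with $s=n^2$ stages is $$P(z)=\frac{n-1}{2n-1}\nu_n(z)^{n^2}+\frac n{2n-1}\nu_n(z)^{(n-1)^2},$$ while its internal stability functions are $$Q_j(z)=\begin{cases}\dfrac{n-1}{2n-1}\nu_n(z)^{n^2-j+1}+\dfrac n{2n-1}\nu_n(z)^{(n-1)^2-j+1}& 2\le j\le m_n,\\[2mm]\dfrac{n-1}{2n-1}\nu_n(z)^{n^2-j+1}& m_n+1\le j\le k_n-1,\\[2mm]\nu_n(z)^{n^2-j+1}& k_n\le j\le n^2.\end{cases}$$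
   Context: The optimal third order SSP Runge--Kutta method with $s=n^2$ stages, implemented in the following form, is $$Y_1=U_n,\qquad Y_j=Y_{j-1}+\frac{\tau}{n^2-n}F(Y_{j-1})\quad(2\le j\le s,\ j\ne k_n),$$ $$Y_{k_n}=\frac{n-1}{2n-1}Y_{k_n-1}+\frac{n}{2n-1}Y_{m_n}+\frac{\tau}{n(2n-1)}F(Y_{k_n-1}),\qquad U_{n+1}=Y_{s+1}=Y_s+\frac{\tau}{n^2-n}F(Y_s)$$ (in $U_n,U_{n+1}$ the subscript is the time-step index). This is of Shu--Osher form $Y_i=v_iU_n+\sum_{j=1}^s(\alpha_{ij}Y_j+\tau\beta_{ij}F(Y_j))$, $1\le i\le s+1$, $U_{n+1}=Y_{s+1}$, with $v_1=1$ and $v_i=0$ for $i\ge2$. Write $\alpha_{1:s},\beta_{1:s}$ for the upper-left $s\times s$ blocks, $\alpha_{s+1},\beta_{s+1}$ for the first $s$ entries of the last rows, and $v_{1:s}=(v_1,\dots,v_s)^\top$. The stability function is $P(z)=v_{s+1}+(\alpha_{s+1}+z\beta_{s+1})(I_s-\alpha_{1:s}-z\beta_{1:s})^{-1}v_{1:s}$ and the internal stability functions are $(Q_1(z),\dots,Q_s(z))=(\alpha_{s+1}+z\beta_{s+1})(I_s-\alpha_{1:s}-z\beta_{1:s})^{-1}$. Equivalently, if the method is applied to $U'=\lambda U$ with $z=\tau\lambda$ and a perturbation $\tilde r_j$ is added to the right-hand side of the equation for each $Y_j$, $1\le j\le s+1$, then $P(z)$ and $Q_j(z)$ are the coefficients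 of $U_n$ and $\tilde r_j$ in the resulting $U_{n+1}$. *)

theory Defs
  imports
    Complex_Main
    "Jordan_Normal_Form.Matrix"
    "Jordan_Normal_Form.Determinant"
    "Jordan_Normal_Form.Gauss_Jordan_Elimination"
begin

text \<open>
  Coefficients of a method in Shu--Osher form. The coefficient functions are indexed from 1:
  rows range over \<open>1, \<dots>, s + 1\<close> and columns over \<open>1, \<dots>, s\<close>, where \<open>s\<close> is the number of stages;
  values outside these ranges are irrelevant.
\<close>

record shu_osher =
  stages :: nat
  so_v :: "nat \<Rightarrow> real"
  so_alpha :: "nat \<Rightarrow> nat \<Rightarrow> real"
  so_beta :: "nat \<Rightarrow> nat \<Rightarrow> real"

text \<open>The equations of one time step; the new approximation is \<open>Y (s + 1)\<close>.\<close>

definition shu_osher_step ::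
    "shu_osher \<Rightarrow> real \<Rightarrow> ('a::real_vector \<Rightarrow> 'a) \<Rightarrow> 'a \<Rightarrow> (nat \<Rightarrow> 'a) \<Rightarrow> bool" where
  "shu_osher_step M \<tau> F U Y \<longleftrightarrow>
     (\<forall>i\<in>{1..stages M + 1}.
        Y i = so_v M i *\<^sub>R U
              + (\<Sum>j = 1..stages M. so_alpha M i j *\<^sub>R Y j + (\<tau> * so_beta M i j) *\<^sub>R F (Y j)))"

text \<open>
  Matrices are indexed from 0, whence the shifts by \<open>Suc\<close>. Row and column vectors are
  \<open>1 \<times> s\<close> and \<open>s \<times> 1\<close> matrices.
\<close>

definition upper_block :: "nat \<Rightarrow> (nat \<Rightarrow> nat \<Rightarrow> real) \<Rightarrow> complex mat" where
  "upper_block s a = mat s s (\<lambda>(i, j). complex_of_real (a (Suc i) (Suc j)))"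

definition last_row :: "nat \<Rightarrow> (nat \<Rightarrow> nat \<Rightarrow> real) \<Rightarrow> complex mat" where
  "last_row s a = mat 1 s (\<lambda>(i, j). complex_of_real (a (s + 1) (Suc j)))"

definition upper_col :: "nat \<Rightarrow> (nat \<Rightarrow> real) \<Rightarrow> complex mat" where
  "upper_col s v = mat s 1 (\<lambda>(i, j). complex_of_real (v (Suc i)))"

definition stage_matrix :: "shu_osher \<Rightarrow> complex \<Rightarrow> complex mat" where
  "stage_matrix M z =
     1\<^sub>m (stages M) - upper_block (stages M) (so_alpha M)
       - z \<cdot>\<^sub>m upper_block (stages M) (so_beta M)"

text \<open>
  The inverse \<open>the (mat_inverse A)\<close> is meaningful only for nonsingular \<open>A\<close>; for the method below
  this is \<open>det_stage_matrix_ssp_rk3\<close>.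
\<close>

definition internal_stability_row :: "shu_osher \<Rightarrow> complex \<Rightarrow> complex mat" where
  "internal_stability_row M z =
     (last_row (stages M) (so_alpha M) + z \<cdot>\<^sub>m last_row (stages M) (so_beta M))
       * the (mat_inverse (stage_matrix M z))"

definition stability_function :: "shu_osher \<Rightarrow> complex \<Rightarrow> complex" where
  "stability_function M z =
     complex_of_real (so_v M (stages M + 1))
       + (internal_stability_row M z * upper_col (stages M) (so_v M)) $$ (0, 0)"

definition internal_stability_function :: "shu_osher \<Rightarrow> nat \<Rightarrow> complex \<Rightarrow> complex" where
  "internal_stability_function M j z = internal_stability_row M z $$ (0, j - 1)"

definition k_idx :: "nat \<Rightarrow> nat" where
  "k_idx n = n * (n + 1) div 2 + 1"

definition m_idx :: "nat \<Rightarrow> nat" where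
  "m_idx n = (n - 1) * (n - 2) div 2 + 1"

definition nu :: "nat \<Rightarrow> complex \<Rightarrow> complex" where
  "nu n z = 1 + z / (of_nat n ^ 2 - of_nat n)"

text \<open>
  The optimal third order SSP Runge--Kutta method with \<open>n\<^sup>2\<close> stages. Its coefficients are read off
  from the stage equations in \<open>shu_osher_step_ssp_rk3_iff\<close>.
\<close>

definition ssp_rk3 :: "nat \<Rightarrow> shu_osher" where
  "ssp_rk3 n =
     \<lparr>stages = n ^ 2,
      so_v = (\<lambda>i. if i = 1 then 1 else 0),
      so_alpha = (\<lambda>i j.
        if i = k_idx n then
          (if j = k_idx n - 1 then (real n - 1) / (2 * real n - 1)
           else if j = m_idx n then real n / (2 * real n - 1)
           else 0)
        else if 2 \<le> i \<and> j = i - 1 then 1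
        else 0),
      so_beta = (\<lambda>i j.
        if i = k_idx n then
          (if j = k_idx n - 1 then 1 / (real n * (2 * real n - 1)) else 0)
        else if 2 \<le> i \<and> j = i - 1 then 1 / (real n ^ 2 - real n)
        else 0)\<rparr>"

lemma two_k_idx: "2 * k_idx n = n * n + n + 2"
proof -
  have "even (n * (n + 1))" by simp
  then show ?thesis unfolding k_idx_def by (auto simp: algebra_simps)
qed

lemma two_m_idx:
  assumes "n \<ge> 2"
  shows "2 * m_idx n + 3 * n = n * n + 4"
proof -
  obtain p where p: "n = p + 2" using assms by (metis add.commute le_Suc_ex)
  have "even ((p + 1) * p)" by simp
  then show ?thesis unfolding m_idx_def p by (auto simp: algebra_simps)
qed

lemma idx_bounds:
  assumes "n \<ge> 2"
  shows "1 \<le> m_idx n" "m_idx n + 2 \<le> k_idx n - 1" "4 \<le> k_idx n" "k_idx n \<le> n ^ 2"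
proof -
  show "1 \<le> m_idx n" by (simp add: m_idx_def)
  have sq: "n * n \<ge> 2 * n" using assms by simp
  show "m_idx n + 2 \<le> k_idx n - 1" "4 \<le> k_idx n"
    using two_k_idx[of n] two_m_idx[OF assms] assms sq by linarith+
  have "n * n \<ge> n + 2"
    using assms sq by linarith
  then show "k_idx n \<le> n ^ 2"
    using two_k_idx[of n] by (simp add: power2_eq_square)
qed

lemma shu_osher_step_ssp_rk3_iff:
  fixes F :: "'a::real_vector \<Rightarrow> 'a"
  assumes n: "n \<ge> 2"
  shows "shu_osher_step (ssp_rk3 n) \<tau> F U Y \<longleftrightarrow>
     Y 1 = U \<and>
     (\<forall>j. 2 \<le> j \<and> j \<le> n ^ 2 \<and> j \<noteq> k_idx n \<longrightarrow>
        Y j = Y (j - 1) + (\<tau> / (real n ^ 2 - real n)) *\<^sub>R F (Y (j - 1))) \<and>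
     Y (k_idx n) = ((real n - 1) / (2 * real n - 1)) *\<^sub>R Y (k_idx n - 1)
                   + (real n / (2 * real n - 1)) *\<^sub>R Y (m_idx n)
                   + (\<tau> / (real n * (2 * real n - 1))) *\<^sub>R F (Y (k_idx n - 1)) \<and>
     Y (n ^ 2 + 1) = Y (n ^ 2) + (\<tau> / (real n ^ 2 - real n)) *\<^sub>R F (Y (n ^ 2))"
proof -
  note b = idx_bounds[OF n]
  define R where "R i = so_v (ssp_rk3 n) i *\<^sub>R U
              + (\<Sum>j = 1..n ^ 2. so_alpha (ssp_rk3 n) i j *\<^sub>R Y j
                                + (\<tau> * so_beta (ssp_rk3 n) i j) *\<^sub>R F (Y j))" for i
  have step: "shu_osher_step (ssp_rk3 n) \<tau> F U Y \<longleftrightarrow> (\<forall>i\<in>{1..n ^ 2 + 1}. Y i = R i)"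
    by (simp add: shu_osher_step_def R_def ssp_rk3_def)
  have R1: "R 1 = U"
    using b by (auto simp: R_def ssp_rk3_def intro!: sum.neutral)
  have Rj: "R i = Y (i - 1) + (\<tau> / (real n ^ 2 - real n)) *\<^sub>R F (Y (i - 1))"
    if i: "2 \<le> i" "i \<le> n ^ 2 + 1" "i \<noteq> k_idx n" for i
  proof -
    have "R i = (\<Sum>j = 1..n ^ 2. if j = i - 1
            then Y (i - 1) + (\<tau> / (real n ^ 2 - real n)) *\<^sub>R F (Y (i - 1)) else 0)"
    proof -
      have "so_v (ssp_rk3 n) i = 0" using i by (simp add: ssp_rk3_def)
      moreover have "so_alpha (ssp_rk3 n) i j *\<^sub>R Y j
            + (\<tau> * so_beta (ssp_rk3 n) i j) *\<^sub>R F (Y j) =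
          (if j = i - 1
            then Y (i - 1) + (\<tau> / (real n ^ 2 - real n)) *\<^sub>R F (Y (i - 1)) else 0)" for j
        using i by (simp add: ssp_rk3_def)
      ultimately show ?thesis unfolding R_def by simp
    qed
    also have "\<dots> = Y (i - 1) + (\<tau> / (real n ^ 2 - real n)) *\<^sub>R F (Y (i - 1))"
      using i by (subst sum.delta) auto
    finally show ?thesis .
  qed
  have Rk: "R (k_idx n) = ((real n - 1) / (2 * real n - 1)) *\<^sub>R Y (k_idx n - 1)
                   + (real n / (2 * real n - 1)) *\<^sub>R Y (m_idx n)
                   + (\<tau> / (real n * (2 * real n - 1))) *\<^sub>R F (Y (k_idx n - 1))"
  proof -
    have "R (k_idx n) = (\<Sum>j = 1..n ^ 2.
            (if j = k_idx n - 1 then ((real n - 1) / (2 * real n - 1)) *\<^sub>R Y (k_idx n - 1)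
                  + (\<tau> / (real n * (2 * real n - 1))) *\<^sub>R F (Y (k_idx n - 1)) else 0)
          + (if j = m_idx n then (real n / (2 * real n - 1)) *\<^sub>R Y (m_idx n) else 0))"
      unfolding R_def using b by (auto simp: ssp_rk3_def intro!: sum.cong)
    also have "\<dots> = ((real n - 1) / (2 * real n - 1)) *\<^sub>R Y (k_idx n - 1)
                  + (\<tau> / (real n * (2 * real n - 1))) *\<^sub>R F (Y (k_idx n - 1))
                  + (real n / (2 * real n - 1)) *\<^sub>R Y (m_idx n)"
    proof -
      have "k_idx n - 1 \<in> {1..n ^ 2}" "m_idx n \<in> {1..n ^ 2}" using b by auto
      then show ?thesis by (simp add: sum.distrib sum.delta)
    qed
    finally show ?thesis by (simp add: algebra_simps)
  qed
  have split: "(\<forall>i\<in>{1..n ^ 2 + 1}. Y i = R i) \<longleftrightarrow>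
      Y 1 = R 1 \<and> (\<forall>i. 2 \<le> i \<and> i \<le> n ^ 2 \<and> i \<noteq> k_idx n \<longrightarrow> Y i = R i) \<and>
      Y (k_idx n) = R (k_idx n) \<and> Y (n ^ 2 + 1) = R (n ^ 2 + 1)" (is "?L \<longleftrightarrow> ?D")
  proof
    assume ?L
    then show ?D using b by auto
  next
    assume D: ?D
    show ?L
    proof
      fix i assume i: "i \<in> {1..n ^ 2 + 1}"
      then consider "i = 1" | "i = k_idx n" | "i = n ^ 2 + 1" | "2 \<le> i" "i \<le> n ^ 2" "i \<noteq> k_idx n"
        by fastforce
      then show "Y i = R i" using D by cases auto
    qed
  qed
  have Rlast: "R (n ^ 2 + 1) = Y (n ^ 2) + (\<tau> / (real n ^ 2 - real n)) *\<^sub>R F (Y (n ^ 2))"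
    using Rj[of "n ^ 2 + 1"] b by simp
  show ?thesis
    unfolding step split R1 Rk Rlast using Rj by auto
qed

lemma det_stage_matrix_ssp_rk3:
  assumes n: "n \<ge> 2"
  shows "det (stage_matrix (ssp_rk3 n) z) = 1"
proof -
  note b = idx_bounds[OF n]
  let ?A = "stage_matrix (ssp_rk3 n) z"
  have dim: "?A \<in> carrier_mat (n ^ 2) (n ^ 2)"
    by (auto simp: stage_matrix_def upper_block_def ssp_rk3_def intro!: carrier_matI)
  have up: "?A $$ (i, j) = (if i = j then 1 else 0)" if "i \<le> j" "j < n ^ 2" for i j
    using that b by (auto simp: stage_matrix_def upper_block_def ssp_rk3_def)
  have "det ?A = prod_list (diag_mat ?A)"
    using up by (intro det_lower_triangular[OF _ dim]) auto
  also have "\<dots> = 1"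
    using up dim unfolding prod_list_diag_prod by (intro prod.neutral) auto
  finally show ?thesis .
qed

end

theory Submission
  imports Defs
begin

text \<open>
  Applied to \<open>U' = \<lambda> U\<close>, every stage is a linear combination of \<open>U\<^sub>n\<close> and the stages, the weight of
  \<open>Y\<^sub>j\<close> in the equation for \<open>Y\<^sub>i\<close> being \<open>\<alpha>\<^sub>i\<^sub>j + z \<beta>\<^sub>i\<^sub>j\<close> (\<open>edge_weight\<close>). A perturbation of
  the equation for \<open>Y\<^sub>j\<close> reaches the new approximation through the stages that use \<open>Y\<^sub>j\<close>, so the
  internal stability functions solve the adjoint recursion \<open>Q\<^sub>j = \<Sum>\<^sub>i Q\<^sub>i (\<alpha>\<^sub>i\<^sub>j + z \<beta>\<^sub>i\<^sub>j)\<close>, the sum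
  running over \<open>1 \<le> i \<le> s + 1\<close> with \<open>Q\<^bsub>s+1\<^esub> = 1\<close>. When the stage matrix is nonsingular the
  recursion has only one solution (\<open>internal_stability_row_eqI\<close>), and it suffices to check a candidate.

  In the method at hand, \<open>Y\<^sub>j\<close> is used by \<open>Y\<^bsub>j+1\<^esub>\<close> with weight \<open>\<nu>\<close>, except that the weight into the
  stage \<open>k\<close> is \<open>(n-1)/(2n-1) \<nu>\<close>, because \<open>1/(n(2n-1)) = (n-1)/(2n-1) \<cdot> 1/(n\<^sup>2-n)\<close>; and
  \<open>Y\<^sub>m\<close> is also used by \<open>Y\<^sub>k\<close>, with weight \<open>n/(2n-1)\<close> (\<open>edge_weight_ssp_rk3\<close>). So \<open>Q\<^sub>j\<close> adds up
  the paths from \<open>j\<close> to \<open>s + 1\<close>: the direct one has \<open>n\<^sup>2 + 1 - j\<close> edges and picks up the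
  factor \<open>(n-1)/(2n-1)\<close> if it enters \<open>k\<close>; for \<open>j \<le> m\<close> there is also the shortcut from \<open>m\<close> to \<open>k\<close>,
  which skips \<open>k - m = 2n - 1\<close> edges and leaves the power \<open>n\<^sup>2 + 1 - j - (2n - 1) = (n-1)\<^sup>2 + 1 - j\<close>.
  Finally, \<open>U\<^sub>n\<close> enters like a perturbation of the first stage, so that \<open>P = Q\<^sub>1\<close>.
\<close>

definition edge_weight :: "shu_osher \<Rightarrow> complex \<Rightarrow> nat \<Rightarrow> nat \<Rightarrow> complex" where
  "edge_weight M z i j = of_real (so_alpha M i j) + z * of_real (so_beta M i j)"

text \<open>
  For a nonsingular stage matrix \<open>A\<close>, the internal stability row is the only solution \<open>x\<close>
  of \<open>x A = b\<close>. Prescribing the value \<open>1\<close> at \<open>s + 1\<close> merges the right-hand side \<open>b\<close>, the last row of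
  the weights, into the sum.
\<close>

lemma internal_stability_row_eqI:
  assumes det: "det (stage_matrix M z) \<noteq> 0"
    and last: "q (stages M + 1) = 1"
    and rec: "\<And>j. j \<in> {1..stages M} \<Longrightarrow>
                q j = (\<Sum>i = 1..stages M + 1. q i * edge_weight M z i j)"
  shows "internal_stability_row M z = mat 1 (stages M) (\<lambda>(i, j). q (Suc j))"
proof -
  let ?s = "stages M"
  let ?A = "stage_matrix M z"
  let ?Q = "mat 1 ?s (\<lambda>(i, j). q (Suc j))"
  let ?b = "last_row ?s (so_alpha M) + z \<cdot>\<^sub>m last_row ?s (so_beta M)"
  have A: "?A \<in> carrier_mat ?s ?s"
    by (auto simp: stage_matrix_def upper_block_def)
  have "?A \<in> Units (ring_mat TYPE(complex) ?s ())"
    by (rule det_non_zero_imp_unit[OF A det])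
  then obtain B where B: "mat_inverse ?A = Some B"
    using mat_inverse(1)[OF A, of "()"] by (cases "mat_inverse ?A") auto
  have inv: "?A * B = 1\<^sub>m ?s" and Bc: "B \<in> carrier_mat ?s ?s"
    using mat_inverse(2)[OF A B] by auto
  have "?b = ?Q * ?A"
  proof (rule eq_matI)
    show "dim_row ?b = dim_row (?Q * ?A)" "dim_col ?b = dim_col (?Q * ?A)"
      using A by (auto simp: last_row_def)
  next
    fix r j assume "r < dim_row (?Q * ?A)" "j < dim_col (?Q * ?A)"
    then have r: "r = 0" and j: "j < ?s" using A by auto
    have "(?Q * ?A) $$ (r, j) = (\<Sum>i<?s. q (Suc i) * ?A $$ (i, j))"
      using A j r by (auto simp: scalar_prod_def lessThan_atLeast0 intro!: sum.cong)
    also have "\<dots> = (\<Sum>i<?s. (if i = j then q (Suc i) else 0)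
                          - q (Suc i) * edge_weight M z (Suc i) (Suc j))"
      using j by (intro sum.cong)
        (auto simp: stage_matrix_def upper_block_def edge_weight_def algebra_simps)
    also have "\<dots> = q (Suc j) - (\<Sum>i<?s. q (Suc i) * edge_weight M z (Suc i) (Suc j))"
      using j by (simp add: sum_subtractf)
    also have "(\<Sum>i<?s. q (Suc i) * edge_weight M z (Suc i) (Suc j))
                 = (\<Sum>i = 1..?s. q i * edge_weight M z i (Suc j))"
      by (simp add: sum.atLeast1_atMost_eq)
    also have "q (Suc j) - \<dots> = edge_weight M z (?s + 1) (Suc j)"
      using rec[of "Suc j"] last j by simp
    also have "\<dots> = ?b $$ (r, j)"
      using r j by (simp add: last_row_def edge_weight_def)
    finally show "?b $$ (r, j) = (?Q * ?A) $$ (r, j)" by simp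
  qed
  then have "internal_stability_row M z = ?Q * ?A * B"
    by (simp add: internal_stability_row_def B)
  also have "\<dots> = ?Q * (?A * B)"
    using A Bc by (intro assoc_mult_mat[of _ 1 ?s _ ?s _ ?s]) auto
  also have "\<dots> = ?Q"
    using inv by simp
  finally show ?thesis .
qed

text \<open>
  Every step to the next stage multiplies by \<open>\<nu>\<close>, also the step into stage \<open>k\<close>: there \<open>\<alpha>\<close> and \<open>\<beta>\<close>
  are both \<open>(n-1)/(2n-1)\<close> times their values elsewhere.
\<close>

lemma edge_weight_ssp_rk3:
  assumes n: "n \<ge> 2" and j: "1 \<le> j"
  shows "edge_weight (ssp_rk3 n) z i j =
     (if i = j + 1
        then (if i = k_idx n then (of_nat n - 1) / (2 * of_nat n - 1) else 1) * nu n z else 0)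
     + (if i = k_idx n \<and> j = m_idx n then of_nat n / (2 * of_nat n - 1) else 0)"
proof -
  note b = idx_bounds[OF n]
  have nz: "of_nat n \<noteq> (0::complex)" "of_nat n - 1 \<noteq> (0::complex)"
    using n by (auto simp: right_minus_eq of_nat_eq_1_iff)
  have "2 * of_nat n - 1 = (of_nat (2 * n - 1) :: complex)"
    using n by (simp add: of_nat_diff)
  also have "\<dots> \<noteq> 0"
    unfolding of_nat_eq_0_iff using n by simp
  finally have nz': "2 * of_nat n - 1 \<noteq> (0::complex)" .
  have square: "of_nat n ^ 2 - of_nat n = of_nat n * (of_nat n - (1::complex))"
    by (simp add: power2_eq_square algebra_simps)
  have into_k: "(of_nat n - 1) / (2 * of_nat n - 1) + z * (1 / (of_nat n * (2 * of_nat n - 1)))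
          = (of_nat n - 1) / (2 * of_nat n - 1) * nu n z"
  proof -
    have "a / d + z * (1 / (m * d)) = a / d * (1 + z / (m * a))"
      if "a \<noteq> 0" "d \<noteq> 0" "m \<noteq> 0" for a d m :: complex
      using that by (simp add: field_simps)
    then show ?thesis unfolding nu_def square using nz nz' by blast
  qed
  consider "i = k_idx n" "j = k_idx n - 1" | "i = k_idx n" "j = m_idx n"
    | "i = k_idx n" "j \<noteq> k_idx n - 1" "j \<noteq> m_idx n" | "i \<noteq> k_idx n"
    by blast
  then show ?thesis
  proof cases
    case 1
    then show ?thesis using b into_k by (simp add: edge_weight_def ssp_rk3_def)
  next
    case 2
    have "k_idx n \<noteq> Suc (m_idx n)" and "m_idx n \<noteq> k_idx n - 1" using b by linarith+
    then show ?thesis using 2 by (simp add: edge_weight_def ssp_rk3_def)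
  next
    case 3
    then show ?thesis using b by (auto simp: edge_weight_def ssp_rk3_def)
  next
    case 4
    then show ?thesis using j by (auto simp: edge_weight_def ssp_rk3_def nu_def)
  qed
qed

text \<open>
  A path from stage \<open>j\<close> to the new approximation contributes the product of its edge weights: the
  first term belongs to the direct path, the second to the one through the shortcut from \<open>m\<close>
  to \<open>k\<close>. At \<open>j = n\<^sup>2 + 1\<close> only the empty path remains, and the value is \<open>1\<close>.
\<close>

definition path_sum :: "nat \<Rightarrow> complex \<Rightarrow> nat \<Rightarrow> complex" where
  "path_sum n z j =
     (if k_idx n \<le> j then 1 else (of_nat n - 1) / (2 * of_nat n - 1)) * nu n z ^ (n ^ 2 + 1 - j)
     + (if j \<le> m_idx n then of_nat n / (2 * of_nat n - 1) * nu n z ^ ((n - 1) ^ 2 + 1 - j) else 0)"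

text \<open>
  Since \<open>n\<^sup>2 - (n-1)\<^sup>2 = 2n - 1\<close>, this is the length \<open>k - m = 2n - 1\<close> of the part that the shortcut
  skips, in a form without truncated subtraction; it is why \<open>(n-1)\<^sup>2\<close> appears in the exponents.
\<close>

lemma k_minus_m_idx:
  assumes "n \<ge> 2"
  shows "n ^ 2 + m_idx n = (n - 1) ^ 2 + k_idx n"
proof -
  obtain p where p: "n = p + 2" using assms by (metis add.commute le_Suc_ex)
  show ?thesis
    using two_k_idx[of n] two_m_idx[OF assms] by (simp add: p power2_eq_square)
qed

text \<open>
  Splitting off the first edge of a path: it leads to \<open>j + 1\<close>, or, for \<open>j = m\<close>, possibly to \<open>k\<close>.
\<close>

lemma path_sum_recursion:
  assumes n: "n \<ge> 2" and j: "j \<in> {1..n ^ 2}"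
  shows "path_sum n z j = (\<Sum>i = 1..n ^ 2 + 1. path_sum n z i * edge_weight (ssp_rk3 n) z i j)"
proof -
  note b = idx_bounds[OF n]
  let ?c = "(of_nat n - 1) / (2 * of_nat n - 1) :: complex"
  let ?d = "of_nat n / (2 * of_nat n - 1) :: complex"
  let ?p = "path_sum n z"
  have "(\<Sum>i = 1..n ^ 2 + 1. ?p i * edge_weight (ssp_rk3 n) z i j)
      = (\<Sum>i = 1..n ^ 2 + 1.
          (if i = j + 1 then ?p (j + 1) * ((if j + 1 = k_idx n then ?c else 1) * nu n z) else 0)
          + (if i = k_idx n then (if j = m_idx n then ?p (k_idx n) * ?d else 0) else 0))"
    using j by (intro sum.cong refl) (simp add: edge_weight_ssp_rk3[OF n] distrib_left)
  also have "\<dots> = ?p (j + 1) * ((if j + 1 = k_idx n then ?c else 1) * nu n z)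
                 + (if j = m_idx n then ?p (k_idx n) * ?d else 0)"
  proof -
    have "j + 1 \<in> {1..n ^ 2 + 1}" "k_idx n \<in> {1..n ^ 2 + 1}" using j b by auto
    then show ?thesis by (simp only: sum.distrib sum.delta finite_atLeastAtMost if_True)
  qed
  also have "\<dots> = ?p j"
  proof -
    have direct: "nu n z ^ (n ^ 2 + 1 - (j + 1)) * nu n z = nu n z ^ (n ^ 2 + 1 - j)"
      using j by (simp add: Suc_diff_le)
    consider "j < m_idx n" | "j = m_idx n" | "m_idx n < j" "j + 1 < k_idx n"
      | "j + 1 = k_idx n" | "k_idx n \<le> j"
      by linarith
    then show ?thesis
    proof cases
      case 1
      then have "j + 1 \<le> (n - 1) ^ 2 + 1"
        using k_minus_m_idx[OF n] b by linarith
      then have shortcut: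
          "nu n z ^ ((n - 1) ^ 2 + 1 - (j + 1)) * nu n z = nu n z ^ ((n - 1) ^ 2 + 1 - j)"
        by (simp add: Suc_diff_le)
      have "\<not> k_idx n \<le> j" "\<not> k_idx n \<le> j + 1" "j + 1 \<noteq> k_idx n" "j \<noteq> m_idx n"
        "j \<le> m_idx n" "j + 1 \<le> m_idx n"
        using 1 b by linarith+
      then show ?thesis
        unfolding path_sum_def direct[symmetric] shortcut[symmetric]
        by (simp only: if_True if_False mult_1 add_0_right) (simp only: algebra_simps)
    next
      case 2
      \<comment> \<open>The edge from \<open>m\<close> to \<open>k\<close> contributes no factor \<open>\<nu>\<close>, so the power at \<open>k\<close> is carried over.\<close>
      then have "n ^ 2 + 1 - k_idx n = (n - 1) ^ 2 + 1 - j"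
        using k_minus_m_idx[OF n] by linarith
      moreover have "\<not> k_idx n \<le> j" "\<not> k_idx n \<le> Suc j" "\<not> k_idx n \<le> m_idx n"
        "Suc j \<noteq> k_idx n" "\<not> Suc j \<le> m_idx n"
        using 2 b by linarith+
      ultimately show ?thesis
        using 2 direct by (simp add: path_sum_def mult_ac)
    next
      case 3
      then show ?thesis using b direct by (simp add: path_sum_def mult_ac)
    next
      case 4
      then have "\<not> k_idx n \<le> j" "\<not> j \<le> m_idx n" "\<not> Suc j \<le> m_idx n" "j \<noteq> m_idx n"
        using b by linarith+
      then show ?thesis using 4 direct by (simp add: path_sum_def mult_ac)
    next
      case 5
      then have "k_idx n \<le> Suc j" "Suc j \<noteq> k_idx n" "\<not> j \<le> m_idx n" "\<not> Suc j \<le> m_idx n"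
        "j \<noteq> m_idx n"
        using b by linarith+
      then show ?thesis using 5 direct by (simp add: path_sum_def mult_ac)
    qed
  qed
  finally show ?thesis by simp
qed

lemma internal_stability_row_ssp_rk3:
  assumes n: "n \<ge> 2"
  shows "internal_stability_row (ssp_rk3 n) z = mat 1 (n ^ 2) (\<lambda>(i, j). path_sum n z (Suc j))"
proof -
  have s: "stages (ssp_rk3 n) = n ^ 2" by (simp add: ssp_rk3_def)
  show ?thesis
    using internal_stability_row_eqI[of "ssp_rk3 n" z "path_sum n z"]
      path_sum_recursion[OF n] det_stage_matrix_ssp_rk3[OF n] idx_bounds[OF n]
    unfolding s by (simp add: path_sum_def)
qed

lemma internal_stability_function_ssp_rk3:
  assumes "n \<ge> 2" and "j \<in> {1..n ^ 2}"
  shows "internal_stability_function (ssp_rk3 n) j z = path_sum n z j"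
proof -
  have "j - 1 < n ^ 2" and "Suc (j - 1) = j" using assms by auto
  then show ?thesis
    using assms(1) by (simp add: internal_stability_function_def internal_stability_row_ssp_rk3)
qed

text \<open>
  \<open>U\<^sub>n\<close> occurs only in the equation for \<open>Y\<^sub>1\<close>, with coefficient \<open>1\<close>, so it acts like a perturbation
  of that equation.
\<close>

lemma stability_function_ssp_rk3:
  assumes n: "n \<ge> 2"
  shows "stability_function (ssp_rk3 n) z = path_sum n z 1"
proof -
  have "stability_function (ssp_rk3 n) z
          = (mat 1 (n ^ 2) (\<lambda>(i, j). path_sum n z (Suc j))
             * upper_col (n ^ 2) (\<lambda>i. if i = 1 then 1 else 0)) $$ (0, 0)"
    using n by (simp add: stability_function_def internal_stability_row_ssp_rk3)
      (simp add: ssp_rk3_def)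
  also have "\<dots> = (\<Sum>j<n ^ 2. if j = 0 then path_sum n z 1 else 0)"
    using n
    by (simp add: scalar_prod_def upper_col_def lessThan_atLeast0 if_distrib sum.delta cong: if_cong)
  also have "\<dots> = path_sum n z 1"
    using n by simp
  finally show ?thesis .
qed

theorem lemma3p8:
  fixes n :: nat and z :: complex
  assumes "n \<ge> 2"
  shows "stability_function (ssp_rk3 n) z =
           (of_nat n - 1) / (2 * of_nat n - 1) * nu n z ^ (n ^ 2)
             + of_nat n / (2 * of_nat n - 1) * nu n z ^ ((n - 1) ^ 2)
       \<and> (\<forall>j. 2 \<le> j \<and> j \<le> m_idx n \<longrightarrow>
            internal_stability_function (ssp_rk3 n) j z =
              (of_nat n - 1) / (2 * of_nat n - 1) * nu n z ^ (n ^ 2 - j + 1)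
                + of_nat n / (2 * of_nat n - 1) * nu n z ^ ((n - 1) ^ 2 - j + 1))
       \<and> (\<forall>j. m_idx n + 1 \<le> j \<and> j \<le> k_idx n - 1 \<longrightarrow>
            internal_stability_function (ssp_rk3 n) j z =
              (of_nat n - 1) / (2 * of_nat n - 1) * nu n z ^ (n ^ 2 - j + 1))
       \<and> (\<forall>j. k_idx n \<le> j \<and> j \<le> n ^ 2 \<longrightarrow>
            internal_stability_function (ssp_rk3 n) j z = nu n z ^ (n ^ 2 - j + 1))"
proof -
  note n = assms and b = idx_bounds[OF assms]
  \<comment> \<open>This bound makes the truncated exponents in the statement agree with those of \<open>path_sum\<close>.\<close>
  have m_le: "m_idx n \<le> (n - 1) ^ 2"
    using k_minus_m_idx[OF n] b by linarith
  have P: "stability_function (ssp_rk3 n) z =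
             (of_nat n - 1) / (2 * of_nat n - 1) * nu n z ^ (n ^ 2)
               + of_nat n / (2 * of_nat n - 1) * nu n z ^ ((n - 1) ^ 2)"
    using b by (simp add: stability_function_ssp_rk3[OF n] path_sum_def)
  have Q: "internal_stability_function (ssp_rk3 n) j z =
             (if k_idx n \<le> j then 1 else (of_nat n - 1) / (2 * of_nat n - 1))
               * nu n z ^ (n ^ 2 - j + 1)
             + (if j \<le> m_idx n
                then of_nat n / (2 * of_nat n - 1) * nu n z ^ ((n - 1) ^ 2 - j + 1) else 0)"
    if "1 \<le> j" "j \<le> n ^ 2" for j
    using that m_le
    by (simp add: internal_stability_function_ssp_rk3[OF n] path_sum_def Suc_diff_le)
  show ?thesis
    using P b by (auto simp: Q)
qed

end
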